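(* For integers $1\leq k\leq r$ let $C_r(k)=\lim_{s\to 1/k}(ks-1)^{[r/k]}\zeta_r(s)$ (the non-zero real constant such that $\zeta_r(s)\sim C_r(k)(ks-1)^{-[r/k]}$ as $s\to 1/k$, where $[x]$ is the integer part of $x$). Then: $$C_r(r)=\frac{(-1)^{r-1}}{r}\quad (r\geq 1),$$ $$C_r(k)=\frac{(-1)^{k-1}}{k}\,\zeta_{r-k}\!\left(\frac{1}{k}\right)\quad (r/2<k\leq r-1),$$ $$C_r(1)=\frac{1}{r!}\quad (r\geq 1),$$ and, for every $k\geq 2$, $$C_{kr}(k)=\frac{(-1)^{(k-1)r}}{k^r\, r!}\quad (r\geq 1),$$ $$C_{kr+\ell}(k)=\frac{(-1)^{(k-1)r}}{k^r\, r!}\,\zeta_{\ell}\!\left(\frac{1}{k}\right)\quad (r\geq 1,\ 1\leq \ell\leq k-1).$$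
   Context: For an integer $r\geq 1$, $\zeta_r(s)=\zeta_r(s,s,\ldots,s)$ denotes the Euler–Zagier $r$-fold zeta-function with all $r$ arguments equal to $s$, i.e. the meromorphic continuation to $\mathbb{C}$ of $\sum_{1\leq m_1<m_2<\cdots<m_r}(m_1m_2\cdots m_r)^{-s}$ (absolutely convergent for $\Re s>1$); $\zeta_1=\zeta$ is the Riemann zeta-function. The function $\zeta_r(s)$ has poles only at $s=1/k$, $1\leq k\leq r$, of order $[r/k]$, so the limit defining $C_r(k)$ exists and is non-zero. For $\ell<k$ the point $1/k$ is not a pole of $\zeta_\ell$, so $\zeta_\ell(1/k)$ is a finite value. *)

theory Defs
  imports "HOL-Complex_Analysis.Complex_Analysis"
begin

definition increasing_tuples :: "nat \<Rightarrow> nat list set" where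
  "increasing_tuples r =
     {ms. length ms = r \<and> sorted_wrt (<) ms \<and> (\<forall>m\<in>set ms. 1 \<le> m)}"

text \<open>
  The property of being ``nicely'' meromorphic makes the continuation unique as a total function:
  the value at a regular point is the limit there, and the value at a pole is 0 by convention.
\<close>

definition multi_zeta :: "nat \<Rightarrow> complex \<Rightarrow> complex" where
  "multi_zeta r = (THE f. f nicely_meromorphic_on UNIV \<and>
     (\<forall>s. 1 < Re s \<longrightarrow>
        ((\<lambda>ms. of_nat (prod_list ms) powr (- s)) has_sum f s) (increasing_tuples r)))"

definition normalized_zeta :: "nat \<Rightarrow> nat \<Rightarrow> complex \<Rightarrow> complex" where
  "normalized_zeta r k s = (of_nat k * s - 1) ^ (r div k) * multi_zeta r s"

definition C :: "nat \<Rightarrow> nat \<Rightarrow> complex" where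
  "C r k = Lim (at (1 / of_nat k)) (normalized_zeta r k)"

end

theory Submission
  imports Defs
begin

text \<open>
  For \<open>Re s > 1\<close>, \<open>\<zeta>\<^sub>r(s)\<close> is the \<open>r\<close>-th elementary symmetric function of the numbers \<open>m\<^sup>-\<^sup>s\<close>, whose
  power sums are \<open>\<zeta>(js)\<close>; Newton's identities
  \<open>r \<zeta>\<^sub>r(s) = \<Sum>\<^bsub>1\<le>j\<le>r\<^esub> (-1)\<^bsup>j-1\<^esup> \<zeta>\<^bsub>r-j\<^esub>(s) \<zeta>(js)\<close>
  therefore continue \<open>\<zeta>\<^sub>r\<close> to the whole plane once \<open>\<zeta>\<close> is continued. Near \<open>s = 1/k\<close> only the
  factor \<open>\<zeta>(ks)\<close> has a pole. Comparing leading coefficients in Newton's identity for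
  \<open>r = qk + l\<close> with \<open>0 \<le> l < k\<close> gives
  \<open>r C\<^sub>r(k) = (-1)\<^bsup>k-1\<^esup> C\<^bsub>r-k\<^esub>(k) + \<Sum>\<^bsub>1\<le>j\<le>l\<^esub> (-1)\<^bsup>j-1\<^esup> C\<^bsub>r-j\<^esub>(k) \<zeta>(j/k)\<close>,
  which is solved by \<open>C\<^sub>r(k) = (-1)\<^bsup>(k-1)q\<^esup> / (k\<^sup>q q!) \<zeta>\<^sub>l(1/k)\<close>.
  This is non-zero because \<open>\<zeta> < 0\<close> on \<open>(0,1)\<close>, so that by Newton's identities again
  \<open>(-1)\<^sup>l \<zeta>\<^sub>l(1/k) > 0\<close>.
\<close>

section \<open>Continuation of the Riemann zeta function\<close>

text \<open>
  Expanding \<open>(n-1)\<^bsup>1-s\<^esup>\<close> binomially in powers of \<open>n\<close> and summing the telescoping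
  differences \<open>(n-1)\<^bsup>1-s\<^esup> - n\<^bsup>1-s\<^esup>\<close> over \<open>n \<ge> 2\<close> expresses \<open>(s-1)(\<zeta>(s)-1)\<close> through the same
  function at \<open>s+1, s+2, \<dots>\<close> and a remainder that converges further to the left.
  In \<open>powr_remainder N s i\<close> the index \<open>i\<close> stands for \<open>n = i + 2\<close>.
\<close>

definition powr_remainder :: "nat \<Rightarrow> complex \<Rightarrow> nat \<Rightarrow> complex" where
  "powr_remainder N s i = of_nat (i + 1) powr (1 - s) -
     (\<Sum>j\<le>N. ((1 - s) gchoose j) * (-1) ^ j * of_nat (i + 2) powr (1 - s - of_nat j))"

text \<open>Up to sign, \<open>a gchoose j\<close> is the rising factorial of \<open>-a\<close> over
  \<open>fact j\<close>, and the triangle inequality bounds it factor by factor. The bound is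
  uniform on the disc of radius \<open>A\<close>, as a Weierstrass majorant requires.\<close>

lemma norm_gbinomial_le_pochhammer:
  fixes a :: complex
  assumes "norm a \<le> A"
  shows "norm (a gchoose j) \<le> pochhammer A j / fact j"
proof -
  have "norm (pochhammer (-a) j) = (\<Prod>i<j. norm (- a + of_nat i))"
    by (simp add: pochhammer_prod prod_norm atLeast0LessThan)
  also have "\<dots> \<le> (\<Prod>i<j. A + of_nat i)"
  proof (intro prod_mono conjI)
    fix i
    have "norm (- a + of_nat i) \<le> norm (-a) + norm (of_nat i :: complex)"
      by (rule norm_triangle_ineq)
    then show "norm (- a + of_nat i) \<le> A + of_nat i" using assms by simp
  qed auto
  finally have "norm (pochhammer (-a) j) \<le> pochhammer A j"
    by (simp add: pochhammer_prod atLeast0LessThan)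
  then show ?thesis
    by (simp add: gbinomial_pochhammer norm_mult norm_divide norm_power divide_right_mono)
qed

text \<open>These are the terms of the binomial series of \<open>(1 - 1/2) powr (-A)\<close>. The
  point 1/2 will dominate 1/n for all n >= 2.\<close>

lemma summable_pochhammer_half:
  fixes A :: real
  shows "summable (\<lambda>j. pochhammer A j / fact j * (1 / 2) ^ j)"
proof -
  have "(\<lambda>n. ((-A) gchoose n) * (- (1 / 2)) ^ n) sums (1 + - (1 / 2)) powr (-A)"
    by (rule gen_binomial_real) simp
  moreover have "((-A) gchoose n) * (- (1 / 2)) ^ n = pochhammer A n / fact n * (1 / 2) ^ n" for n
    by (simp add: gbinomial_pochhammer power_minus[of "1/2::real"])
  ultimately show ?thesis by (simp add: sums_iff)
qed

lemma norm_of_nat_powr: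
  assumes "n > 0"
  shows "norm (of_nat n powr s :: complex) = real n powr Re s"
  using assms norm_powr_real_powr[of "of_nat n" s] by simp

text \<open>With n = i + 2, the remainder is the tail from index N + 1 of the binomial series of
  \<open>(n - 1) powr (1 - s)\<close>. Pulling out \<open>n powr (- Re s - N)\<close> leaves powers
  of 1/n <= 1/2, so \<open>K\<close> depends on \<open>A\<close> and \<open>N\<close> only.\<close>

lemma norm_powr_remainder_le:
  obtains K where "\<And>s i. norm (1 - s) \<le> A \<Longrightarrow>
    norm (powr_remainder N s i) \<le> K * real (i + 2) powr (- Re s - real N)"
proof
  fix s :: complex and i :: nat
  assume A: "norm (1 - s) \<le> A"
  define n where "n = i + 2"
  have n: "real n \<ge> 2" by (simp add: n_def)
  define a where "a = 1 - s"
  define t where "t j = (a gchoose j) * (-1) ^ j * of_nat n powr (a - of_nat j)" for j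
  define c where "c j = pochhammer A j / fact j" for j
  have "(\<lambda>j. (a gchoose j) * of_real (real n) powr (a - of_nat j) * of_real (-1) ^ j) sums
               of_real (real n + -1) powr a"
    by (rule gen_binomial_complex'') (use n in auto)
  moreover have "complex_of_real (real n + -1) = of_nat (i + 1)"
    by (simp add: n_def)
  ultimately have "t sums (of_nat (i + 1) powr a)"
    unfolding t_def by (simp add: mult_ac)
  then have "(\<lambda>j. t (j + Suc N)) sums (of_nat (i + 1) powr a - (\<Sum>j<Suc N. t j))"
    by (subst sums_iff_shift) simp
  then have zs: "(\<lambda>j. t (j + Suc N)) sums powr_remainder N s i"
    by (simp add: powr_remainder_def t_def a_def n_def lessThan_Suc_atMost)
  have c0: "c j \<ge> 0" for j
    unfolding c_def using norm_gbinomial_le_pochhammer[OF A, of j] by (meson norm_ge_zero order_trans)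
  have sc: "summable (\<lambda>j. c (j + Suc N) * (1 / 2) ^ (j + Suc N))"
    using summable_pochhammer_half[of A] by (subst summable_iff_shift) (simp add: c_def)
  have sc': "summable (\<lambda>j. c (j + Suc N) * (1 / 2) ^ j)"
    using summable_mult[OF sc, of "2 ^ Suc N"] 
    by (rule back_subst[of summable]) (auto simp: fun_eq_iff power_add field_simps)
  have le: "norm (t (j + Suc N)) \<le> c (j + Suc N) * (1 / 2) ^ j * real n powr (- Re s - real N)" for j
  proof -
    have "norm (t (j + Suc N)) = norm (a gchoose (j + Suc N)) * real n powr (1 - Re s - (j + Suc N))"
      using n by (simp add: t_def norm_mult norm_power norm_of_nat_powr a_def)
    also have "real n powr (1 - Re s - (j + Suc N)) = real n powr (- Re s - real N) * real n powr (- real j)"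
      by (simp add: powr_add[symmetric] algebra_simps)
    also have "real n powr (- real j) = (1 / real n) ^ j"
      using n by (simp add: powr_minus powr_realpow field_simps)
    also have "norm (a gchoose (j + Suc N)) * (real n powr (- Re s - real N) * (1 / real n) ^ j) \<le>
       c (j + Suc N) * (real n powr (- Re s - real N) * (1 / 2) ^ j)"
      using n norm_gbinomial_le_pochhammer[OF A, of "j + Suc N"] c0[of "j + Suc N"]
      by (intro mult_mono power_mono) (auto simp: c_def a_def field_simps simp del: power_divide)
    finally show ?thesis by (simp add: mult_ac)
  qed
  have "norm (powr_remainder N s i) \<le> (\<Sum>j. c (j + Suc N) * (1 / 2) ^ j * real n powr (- Re s - real N))"
    unfolding sums_unique[OF zs] by (rule norm_suminf_le[OF le summable_mult2[OF sc']])
  also have "\<dots> = (\<Sum>j. c (j + Suc N) * (1 / 2) ^ j) * real n powr (- Re s - real N)"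
    using sc' by (rule suminf_mult2[symmetric])
  finally show "norm (powr_remainder N s i) \<le> (\<Sum>j. pochhammer A (j + Suc N) / fact (j + Suc N) * (1 / 2) ^ j)
     * real (i + 2) powr (- Re s - real N)" by (simp add: c_def n_def)
qed

section \<open>Convergence and holomorphy of the summed remainders\<close>

lemma summable_shift2_powr:
  fixes p :: real
  assumes "p < -1"
  shows "summable (\<lambda>i. real (i + 2) powr p)"
  using assms summable_iff_shift[of "\<lambda>i. real i powr p" 2] by (simp add: summable_real_powr_iff)

lemma summable_powr_remainder:
  assumes "Re s > 1 - real N"
  shows "summable (powr_remainder N s)"
proof -
  obtain K where K: "\<And>s' i. norm (1 - s') \<le> norm (1 - s) \<Longrightarrow>
    norm (powr_remainder N s' i) \<le> K * real (i + 2) powr (- Re s' - real N)"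
    using norm_powr_remainder_le by metis
  show ?thesis
    by (rule summable_comparison_test'[OF summable_mult[OF summable_shift2_powr]])
      (use assms K[of s] in auto)
qed

lemma open_half_plane: "open {s. Re s > c}"
  using open_halfspace_Re_gt by simp

lemma connected_half_plane: "connected {s. Re s > c}"
  by (intro convex_connected convex_halfspace_Re_gt)

lemma gbinomial_holomorphic [holomorphic_intros]:
  assumes "f holomorphic_on S"
  shows "(\<lambda>s. f s gchoose j) holomorphic_on S"
  unfolding gbinomial_prod_rev by (intro holomorphic_intros assms) auto

lemma powr_remainder_holomorphic: "(\<lambda>s. powr_remainder N s i) holomorphic_on S"
  unfolding powr_remainder_def by (intro holomorphic_intros)

lemma powr_remainder_suminf_holomorphic:
  "(\<lambda>s. suminf (powr_remainder N s)) holomorphic_on {s. Re s > 1 - real N}"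
proof (rule holomorphic_uniform_sequence[OF open_half_plane])
  show "(\<lambda>s. \<Sum>i<n. powr_remainder N s i) holomorphic_on {s. Re s > 1 - real N}" for n
    by (intro holomorphic_intros powr_remainder_holomorphic)
next
  fix s :: complex
  assume "s \<in> {s. Re s > 1 - real N}"
  then have s: "Re s > 1 - real N" by simp
  \<comment> \<open>Half the distance to the boundary line: on the closed disc of radius
    \<open>d\<close> the exponent \<open>- Re w - N\<close> stays uniformly below -1.\<close>
  define d where "d = (Re s - (1 - real N)) / 2"
  have d: "d > 0" using s by (simp add: d_def)
  obtain K where K: "\<And>s' i. norm (1 - s') \<le> norm (1 - s) + d \<Longrightarrow>
    norm (powr_remainder N s' i) \<le> K * real (i + 2) powr (- Re s' - real N)"
    using norm_powr_remainder_le by metis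
  have re: "Re w \<ge> Re s - d" and no: "norm (1 - w) \<le> norm (1 - s) + d" if "w \<in> cball s d" for w
  proof -
    have "norm (s - w) \<le> d" using that by (simp add: dist_norm)
    then show "Re w \<ge> Re s - d" using abs_Re_le_cmod[of "s - w"] by simp
    have "1 - w = (1 - s) + (s - w)" by simp
    then show "norm (1 - w) \<le> norm (1 - s) + d"
      using norm_triangle_ineq[of "1 - s" "s - w"] \<open>norm (s - w) \<le> d\<close> by simp
  qed
  have "uniform_limit (cball s d) (\<lambda>n w. \<Sum>i<n. powr_remainder N w i) (\<lambda>w. suminf (powr_remainder N w)) sequentially"
  proof (rule Weierstrass_m_test)
    show "summable (\<lambda>i. \<bar>K\<bar> * real (i + 2) powr (- (Re s - d) - real N))"
      by (intro summable_mult summable_shift2_powr) (use s in \<open>simp add: d_def field_simps\<close>)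
    fix i w assume w: "w \<in> cball s d"
    have "norm (powr_remainder N w i) \<le> K * real (i + 2) powr (- Re w - real N)"
      using K no w by blast
    \<comment> \<open>Monotonicity in the exponent needs a non-negative factor, and \<open>K\<close>
      comes without a sign.\<close>
    also have "\<dots> \<le> \<bar>K\<bar> * real (i + 2) powr (- (Re s - d) - real N)"
      using re[OF w] by (intro mult_mono powr_mono) auto
    finally show "norm (powr_remainder N w i) \<le> \<bar>K\<bar> * real (i + 2) powr (- (Re s - d) - real N)" .
  qed
  moreover have "cball s d \<subseteq> {s. Re s > 1 - real N}"
    using re d by (force simp: d_def field_simps)
  ultimately show "\<exists>d>0. cball s d \<subseteq> {s. Re s > 1 - real N} \<and>
      uniform_limit (cball s d) (\<lambda>n w. \<Sum>i<n. powr_remainder N w i) (\<lambda>w. suminf (powr_remainder N w)) sequentially"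
    using d by blast
qed

section \<open>Recursion from half-plane to half-plane\<close>

lemma summable_nat_powr:
  assumes "Re s > 1"
  shows "summable (\<lambda>i. norm (of_nat (Suc i) powr (- s) :: complex))"
proof -
  have "summable (\<lambda>i. real (Suc i) powr (- Re s))"
    using assms by (subst summable_Suc_iff) (simp add: summable_real_powr_iff)
  then show ?thesis
    by (rule back_subst[of summable]) (simp add: fun_eq_iff norm_of_nat_powr del: of_nat_Suc)
qed

lemma summable_nat_powr2:
  assumes "Re s > 1"
  shows "summable (\<lambda>i. of_nat (i + 2) powr (- s) :: complex)"
  using summable_norm_cancel[OF summable_nat_powr[OF assms]]
    summable_Suc_iff[of "\<lambda>i. of_nat (Suc i) powr (- s) :: complex"] by simp

lemma telescope_nat_powr:
  assumes "Re s > 1"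
  shows "(\<lambda>i. of_nat (i + 1) powr (1 - s) - of_nat (i + 2) powr (1 - s) :: complex) sums 1"
proof -
  have "(\<lambda>i. of_nat (Suc i) powr (1 - s) :: complex) \<longlonglongrightarrow> 0"
  proof (rule tendsto_norm_zero_cancel)
    have "(\<lambda>i. real (Suc i) powr (1 - Re s)) \<longlonglongrightarrow> 0"
      by (rule LIMSEQ_Suc[where f = "\<lambda>i. real i powr (1 - Re s)"], rule tendsto_neg_powr)
        (use assms filterlim_real_sequentially in auto)
    then show "(\<lambda>i. norm (of_nat (Suc i) powr (1 - s) :: complex)) \<longlonglongrightarrow> 0"
      by (rule back_subst[of "\<lambda>f. f \<longlonglongrightarrow> 0"])
        (simp add: fun_eq_iff norm_of_nat_powr del: of_nat_Suc)
  qed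
  from telescope_sums'[OF this] show ?thesis by simp
qed

text \<open>In the remainders summed over n >= 2, the leading binomial term telescopes to 1 and the
  term of index k + 1 gives a multiple of the sum at s + k. Absorption of k + 1 in the binomial
  coefficient produces the factor s + k - 1 contained in \<open>G (s + of_nat k)\<close>.\<close>

lemma powr_remainder_identity:
  fixes G :: "complex \<Rightarrow> complex"
  assumes s: "Re s > 1"
    and G: "\<And>w. Re w > 1 \<Longrightarrow> G w = (w - 1) * (\<Sum>i. of_nat (i + 2) powr (- w))"
  shows "(\<Sum>k\<le>N. (-1) ^ k * ((1 - s) gchoose k) / of_nat (Suc k) * G (s + of_nat k))
           + suminf (powr_remainder (Suc N) s) = 1"
proof -
  define Z where "Z w = (\<Sum>i. of_nat (i + 2) powr (- w) :: complex)" for w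
  define b where "b k = ((1 - s) gchoose (Suc k)) * (-1) ^ (Suc k)" for k
  have Z: "(\<lambda>i. of_nat (i + 2) powr (- w)) sums Z w" if "Re w > 1" for w
    unfolding Z_def using summable_nat_powr2[OF that] by (rule summable_sums)
  have "(\<lambda>i. (of_nat (i + 1) powr (1 - s) - of_nat (i + 2) powr (1 - s)) -
      (\<Sum>k\<le>N. b k * of_nat (i + 2) powr (- (s + of_nat k)))) sums
      (1 - (\<Sum>k\<le>N. b k * Z (s + of_nat k)))"
    by (intro sums_diff telescope_nat_powr s sums_sum sums_mult Z) (use s in auto)
  moreover have "(of_nat (i + 1) powr (1 - s) - of_nat (i + 2) powr (1 - s)) -
      (\<Sum>k\<le>N. b k * of_nat (i + 2) powr (- (s + of_nat k))) = powr_remainder (Suc N) s i" for i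
    unfolding powr_remainder_def b_def sum.atMost_Suc_shift by (simp add: algebra_simps)
  ultimately have "powr_remainder (Suc N) s sums (1 - (\<Sum>k\<le>N. b k * Z (s + of_nat k)))"
    by (simp only: )
  moreover have "(-1) ^ k * ((1 - s) gchoose k) / of_nat (Suc k) * G (s + of_nat k)
      = b k * Z (s + of_nat k)" for k
  proof -
    have step: "(1 - s) gchoose (Suc k) = (1 - s - of_nat k) * ((1 - s) gchoose k) / of_nat (Suc k)"
      by (simp add: gbinomial_prod_rev field_simps)
    have "b k * Z (s + of_nat k) = (-1) ^ k * ((1 - s) gchoose k) / of_nat (Suc k) *
        ((s + of_nat k - 1) * Z (s + of_nat k))"
      unfolding b_def step by (simp add: algebra_simps diff_divide_distrib add_divide_distrib)
    then show ?thesis using s by (simp add: G Z_def)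
  qed
  ultimately show ?thesis by (simp add: sums_iff)
qed

text \<open>This is the identity solved for its k = 0 term, which is \<open>G s\<close>. The shifted
  arguments lie further right, so each level gains a strip of width 1 on the left.\<close>

primrec zeta_strip :: "nat \<Rightarrow> complex \<Rightarrow> complex" where
  "zeta_strip 0 s = 1 - suminf (powr_remainder 1 s)"
| "zeta_strip (Suc N) s = 1 - suminf (powr_remainder (Suc (Suc N)) s) -
     (\<Sum>k=1..Suc N. (-1) ^ k * ((1 - s) gchoose k) / of_nat (Suc k) * zeta_strip N (s + of_nat k))"

lemma zeta_strip_eq:
  "Re s > 1 \<Longrightarrow> zeta_strip N s = (s - 1) * (\<Sum>i. of_nat (i + 2) powr (- s))"
proof (induction N arbitrary: s)
  case 0
  then show ?case
    using powr_remainder_identity[of s "\<lambda>w. (w - 1) * (\<Sum>i. of_nat (i + 2) powr (- w))" 0]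
    by (simp add: algebra_simps)
next
  case (Suc N)
  define g where "g w = (w - 1) * (\<Sum>i. of_nat (i + 2) powr (- w))" for w :: complex
  have "(\<Sum>k\<le>Suc N. (-1) ^ k * ((1 - s) gchoose k) / of_nat (Suc k) * g (s + of_nat k))
           + suminf (powr_remainder (Suc (Suc N)) s) = 1"
    using Suc.prems by (rule powr_remainder_identity) (simp add: g_def)
  moreover have "{..Suc N} = insert 0 {1..Suc N}" by auto
  moreover have "zeta_strip N (s + of_nat k) = g (s + of_nat k)" for k
    using Suc by (simp add: g_def)
  ultimately show ?case unfolding g_def[symmetric]
    by (simp add: algebra_simps of_nat_Suc[of 0] del: sum.cl_ivl_Suc of_nat_Suc)
qed

lemma zeta_strip_holomorphic: "zeta_strip N holomorphic_on {s. Re s > - real N}"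
proof (induction N)
  case 0
  show ?case using powr_remainder_suminf_holomorphic[of 1] by (auto intro!: holomorphic_intros)
next
  case (Suc N)
  have "(\<lambda>s. zeta_strip N (s + of_nat k)) holomorphic_on {s. Re s > - real (Suc N)}"
    if "k \<in> {1..Suc N}" for k
    using that
    by (intro holomorphic_on_compose_gen[OF _ Suc.IH, unfolded o_def] holomorphic_intros) auto
  then show ?case
    using powr_remainder_suminf_holomorphic[of "Suc (Suc N)"]
    by (auto intro!: holomorphic_intros simp del: sum.cl_ivl_Suc of_nat_Suc)
qed

text \<open>All levels equal the same series on Re s > 1; the identity theorem extends this to the
  common half-plane, which permits gluing.\<close>

lemma zeta_strip_unique:
  assumes "Re s > - real M" "Re s > - real N"
  shows "zeta_strip M s = zeta_strip N s"
proof (rule analytic_continuation_open[where s = "{s. Re s > 1}" and s' = "{s. Re s > - real (min M N)}"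
      and f = "zeta_strip M" and g = "zeta_strip N"])
  show "zeta_strip M holomorphic_on {s. Re s > - real (min M N)}"
    "zeta_strip N holomorphic_on {s. Re s > - real (min M N)}"
    by (rule holomorphic_on_subset[OF zeta_strip_holomorphic]; force)+
  have "(2::complex) \<in> {s. Re s > 1}" by simp
  then show "{s. Re s > 1} \<noteq> {}" by blast
qed (use assms in \<open>auto simp: open_half_plane connected_half_plane zeta_strip_eq\<close>)

text \<open>The entire function \<open>(s-1)(\<zeta>(s)-1)\<close>.\<close>

definition zeta_reg :: "complex \<Rightarrow> complex" where
  "zeta_reg s = zeta_strip (nat \<lceil>1 - Re s\<rceil>) s"

lemma zeta_reg_eq:
  assumes "Re s > - real N"
  shows "zeta_reg s = zeta_strip N s"
  unfolding zeta_reg_def by (rule zeta_strip_unique) (use assms in linarith)+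

lemma zeta_reg_holomorphic: "zeta_reg holomorphic_on UNIV"
proof -
  have "zeta_reg analytic_on {s}" for s
  proof -
    \<comment> \<open>The level chosen for \<open>s\<close> is valid on a whole open half-plane
      around \<open>s\<close>, so locally a single holomorphic function represents
      \<open>zeta_reg\<close>.\<close>
    define N where "N = nat \<lceil>1 - Re s\<rceil>"
    have "zeta_reg holomorphic_on {s. Re s > - real N}"
      using zeta_strip_holomorphic[of N] by (rule holomorphic_transform) (simp add: zeta_reg_eq)
    moreover have "Re s > - real N" unfolding N_def by linarith
    ultimately show ?thesis
      using open_half_plane[of "- real N"] by (auto simp: analytic_at)
  qed
  then show ?thesis
    using analytic_imp_holomorphic analytic_on_analytic_at by blast
qed

text \<open>At the pole \<open>s = 1\<close> the value is \<open>1\<close>, since \<open>x/0 = 0\<close>.\<close>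

definition zeta :: "complex \<Rightarrow> complex" where
  "zeta s = 1 + zeta_reg s / (s - 1)"

lemma zeta_sums:
  assumes "Re s > 1"
  shows "(\<lambda>i. of_nat (Suc i) powr (- s)) sums zeta s"
proof -
  have "s \<noteq> 1" using assms by auto
  then have "zeta s = 1 + (\<Sum>i. of_nat (i + 2) powr (- s))"
    using assms zeta_reg_eq[of 0 s] zeta_strip_eq[of s 0] by (simp add: zeta_def)
  moreover have "(\<lambda>i. of_nat (i + 2) powr (- s)) sums (\<Sum>i. of_nat (i + 2) powr (- s) :: complex)"
    by (rule summable_sums[OF summable_nat_powr2[OF assms]])
  then have "(\<lambda>i. of_nat (Suc (Suc i)) powr (- s)) sums (\<Sum>i. of_nat (i + 2) powr (- s) :: complex)"
    by simp
  ultimately show ?thesis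
    using sums_Suc[of "\<lambda>i. of_nat (Suc i) powr (- s)"] by (simp add: add.commute[of 1])
qed

lemma zeta_analytic: "zeta analytic_on - {1}"
proof -
  have "zeta holomorphic_on - {1}"
    unfolding zeta_def
    by (intro holomorphic_intros holomorphic_on_subset[OF zeta_reg_holomorphic]) auto
  then show ?thesis by (simp add: analytic_on_open open_delete[OF open_UNIV, of 1, folded Compl_eq_Diff_UNIV])
qed

text \<open>At s = 1 the remainders with N = 1 all vanish, so \<open>zeta_reg 1 = 1\<close>, and
  this value is the residue.\<close>

lemma zeta_pole_at_1: "((\<lambda>s. (s - 1) * zeta s) \<longlongrightarrow> 1) (at 1)"
proof -
  \<comment> \<open>Since \<open>0 powr 0 = 0\<close>, a power with exponent 0 simplifies to 1 only
    for a base known to be non-zero.\<close>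
  have "of_nat (i + 1) \<noteq> (0 :: complex)" "of_nat (i + 2) \<noteq> (0 :: complex)" for i
    by (simp_all only: of_nat_eq_0_iff)
  then have "powr_remainder 1 1 i = 0" for i by (simp add: powr_remainder_def del: of_nat_add)
  then have "powr_remainder 1 1 = (\<lambda>i. 0)" by blast
  then have 1: "zeta_reg 1 = 1" using zeta_reg_eq[of 0 1] by simp
  have "isCont zeta_reg 1"
    using zeta_reg_holomorphic holomorphic_on_imp_continuous_on continuous_on_eq_continuous_at[of UNIV zeta_reg] by blast
  then have "((\<lambda>s. (s - 1) + zeta_reg s) \<longlongrightarrow> (1 - 1) + 1) (at 1)"
    unfolding isCont_def 1 by (intro tendsto_intros)
  moreover have "\<forall>\<^sub>F s in at 1. (s - 1) + zeta_reg s = (s - 1) * zeta s"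
    by (auto simp: eventually_at_filter zeta_def field_simps)
  ultimately show ?thesis by (simp add: Lim_transform_eventually)
qed

text \<open>The concave function \<open>t powr (1 - x)\<close> lies below its tangent at t = m + 1;
  this is the sign of one remainder.\<close>

lemma powr_concave_step:
  fixes x m :: real
  assumes x: "0 < x" "x < 1" and m: "m > 0"
  shows "m powr (1 - x) \<le> (m + 1) powr (1 - x) - (1 - x) * (m + 1) powr (- x)"
proof -
  have "\<exists>z>m. z < m + 1 \<and> (m + 1) powr (1 - x) - m powr (1 - x) = (m + 1 - m) * ((1 - x) * z powr (1 - x - 1))"
    by (rule MVT2) (use m in \<open>auto intro!: derivative_eq_intros\<close>)
  then obtain z where z: "z > m" "z < m + 1"
    "(m + 1) powr (1 - x) - m powr (1 - x) = (1 - x) * z powr (- x)" by auto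
  have "(m + 1) powr (- x) \<le> z powr (- x)" using z m x by (intro powr_mono2') auto
  then have "(1 - x) * (m + 1) powr (- x) \<le> (1 - x) * z powr (- x)" using x by (intro mult_left_mono) auto
  then show ?thesis using z by simp
qed

text \<open>For \<open>0 < x < 1\<close> all remainders are \<open>\<le> 0\<close> by concavity, whence \<open>(x-1)(\<zeta>(x)-1) \<ge> 1\<close>.\<close>

lemma zeta_neg:
  assumes "0 < x" "x < 1"
  shows "\<exists>y<0. zeta (of_real x) = of_real y"
proof -
  define r where "r i = real (i + 1) powr (1 - x) - real (i + 2) powr (1 - x) + (1 - x) * real (i + 2) powr (- x)" for i
  have "powr_remainder 1 (of_real x) i = of_real (r i)" for i
  proof -
    have "of_nat (i + 1) powr (1 - of_real x) = complex_of_real (real (i + 1) powr (1 - x))"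
      "of_nat (i + 2) powr (1 - of_real x) = complex_of_real (real (i + 2) powr (1 - x))"
      "of_nat (i + 2) powr (- of_real x) = complex_of_real (real (i + 2) powr (- x))"
      using powr_of_real[of "real (i + 1)" "1 - x"] powr_of_real[of "real (i + 2)" "1 - x"]
         powr_of_real[of "real (i + 2)" "- x"] by simp_all
    then show ?thesis by (simp add: powr_remainder_def r_def algebra_simps)
  qed
  then have eq: "powr_remainder 1 (of_real x) = (\<lambda>i. of_real (r i))" by blast
  have "summable (powr_remainder 1 (of_real x))" by (rule summable_powr_remainder) (use assms in simp)
  then have sr: "summable r" unfolding eq by (simp add: summable_of_real_iff)
  have "r i \<le> 0" for i
    using powr_concave_step[OF assms, of "real (i + 1)"] by (simp add: r_def algebra_simps)
  then have r0: "suminf r \<le> 0" using suminf_le[OF _ sr summable_zero] by simp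
  \<comment> \<open>Level 0 already covers Re s > 0. The value is at least 1, and dividing it by x -
    1, which lies in (-1, 0), gives a quotient below -1.\<close>
  have "zeta_reg (of_real x) = of_real (1 - suminf r)"
    using zeta_reg_eq[of 0 "of_real x"] assms by (simp add: eq[simplified] suminf_of_real[OF sr])
  then have "zeta (of_real x) = of_real (1 + (1 - suminf r) / (x - 1))"
    by (simp add: zeta_def)
  moreover have "1 + (1 - suminf r) / (x - 1) < 0"
    using assms r0 by (simp add: field_simps)
  ultimately show ?thesis by blast
qed

section \<open>Newton's identities for sums over increasing tuples\<close>

text \<open>The elementary symmetric polynomial of degree \<open>r\<close> in \<open>x 1\<close>,
  ..., \<open>x M\<close>, split by whether the last variable occurs.\<close>

primrec esym :: "(nat \<Rightarrow> 'a::comm_semiring_1) \<Rightarrow> nat \<Rightarrow> nat \<Rightarrow> 'a" where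
  "esym x 0 r = (if r = 0 then 1 else 0)"
| "esym x (Suc M) r = esym x M r + (case r of 0 \<Rightarrow> 0 | Suc r' \<Rightarrow> x (Suc M) * esym x M r')"

lemma esym_0 [simp]: "esym x M 0 = 1"
  by (induction M) simp_all

text \<open>The generating series E is the product of the factors 1 + x_m X, and the identity is X
  E' = E P with P equal to X times the logarithmic derivative. Adjoining a variable c multiplies E
  by 1 + cX and adds the geometric series \<open>Q\<close> of cX/(1 + cX) to P.\<close>

lemma esym_newton_fps:
  fixes x :: "nat \<Rightarrow> 'a::field_char_0"
  shows "fps_X * fps_deriv (Abs_fps (esym x M)) =
    Abs_fps (esym x M) * Abs_fps (\<lambda>j. if j = 0 then 0 else (-1) ^ (j - 1) * (\<Sum>m=1..M. x m ^ j))"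
proof (induction M)
  case 0
  have "Abs_fps (esym x 0) = 1" by (simp add: fps_eq_iff)
  moreover have "Abs_fps (\<lambda>j. if j = 0 then 0 else (-1) ^ (j - 1) * (\<Sum>m=1..0. x m ^ j)) = 0"
    by (simp add: fps_eq_iff)
  ultimately show ?case by (simp only: fps_deriv_1 mult_zero_right)
next
  case (Suc M)
  define E where "E = Abs_fps (esym x M)"
  define P where "P = Abs_fps (\<lambda>j. if j = 0 then 0 else (-1) ^ (j - 1) * (\<Sum>m=1..M. x m ^ j))"
  define c where "c = x (Suc M)"
  define Q where "Q = Abs_fps (\<lambda>j. if j = 0 then 0 else (-1) ^ (j - 1) * c ^ j)"
  have E: "Abs_fps (esym x (Suc M)) = (1 + fps_const c * fps_X) * E"
  proof (rule fps_ext)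
    show "fps_nth (Abs_fps (esym x (Suc M))) n = fps_nth ((1 + fps_const c * fps_X) * E) n" for n
      by (cases n) (simp_all add: E_def c_def distrib_right mult.assoc)
  qed
  have P: "Abs_fps (\<lambda>j. if j = 0 then 0 else (-1) ^ (j - 1) * (\<Sum>m=1..Suc M. x m ^ j)) = P + Q"
    by (simp add: fps_eq_iff P_def Q_def c_def distrib_left)
  have Q: "(1 + fps_const c * fps_X) * Q = fps_const c * fps_X"
  proof (rule fps_ext)
    fix n
    show "fps_nth ((1 + fps_const c * fps_X) * Q) n = fps_nth (fps_const c * fps_X) n"
    proof (cases n)
      case (Suc k)
      then show ?thesis
        by (cases k) (auto simp: Q_def distrib_right mult.assoc)
    qed (simp add: Q_def distrib_right mult.assoc)
  qed
  have IH: "fps_X * fps_deriv E = E * P" using Suc by (simp add: E_def P_def)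
  have "fps_X * fps_deriv ((1 + fps_const c * fps_X) * E) =
      (1 + fps_const c * fps_X) * (fps_X * fps_deriv E) + fps_const c * fps_X * E"
    by (simp add: algebra_simps)
  also have "\<dots> = (1 + fps_const c * fps_X) * (E * P) + (1 + fps_const c * fps_X) * Q * E"
    by (simp only: IH Q)
  finally show ?case unfolding E P by (simp add: algebra_simps)
qed

lemma esym_newton:
  fixes x :: "nat \<Rightarrow> 'a::field_char_0"
  shows "of_nat r * esym x M r = (\<Sum>j=1..r. (-1) ^ (j - 1) * esym x M (r - j) * (\<Sum>m=1..M. x m ^ j))"
proof -
  have "of_nat r * esym x M r = fps_nth (fps_X * fps_deriv (Abs_fps (esym x M))) r"
    by (cases r) auto
  also have "\<dots> = (\<Sum>j=0..r. (if j = 0 then 0 else (-1) ^ (j - 1) * (\<Sum>m=1..M. x m ^ j)) * esym x M (r - j))"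
    unfolding esym_newton_fps by (subst mult.commute, simp add: fps_mult_nth)
  also have "\<dots> = (\<Sum>j=1..r. (-1) ^ (j - 1) * esym x M (r - j) * (\<Sum>m=1..M. x m ^ j))"
    by (subst sum.atLeast_Suc_atMost) (auto intro!: sum.cong)
  finally show ?thesis .
qed

section \<open>From finite symmetric sums to the infinite sum over increasing tuples\<close>

definition bounded_tuples :: "nat \<Rightarrow> nat \<Rightarrow> nat list set" where
  "bounded_tuples M r = {ms \<in> increasing_tuples r. \<forall>m\<in>set ms. m \<le> M}"

lemma finite_bounded_tuples: "finite (bounded_tuples M r)"
  by (rule finite_subset[OF _ finite_lists_length_eq[of "{..M}" r]])
    (auto simp: bounded_tuples_def increasing_tuples_def)

lemma bounded_tuples_0: "bounded_tuples M 0 = {[]}"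
  by (auto simp: bounded_tuples_def increasing_tuples_def)

lemma append1_in_bounded_tuples_iff:
  "ns @ [m] \<in> bounded_tuples M (Suc r) \<longleftrightarrow>
     ns \<in> increasing_tuples r \<and> (\<forall>n\<in>set ns. n < m) \<and> 1 \<le> m \<and> m \<le> M"
  unfolding bounded_tuples_def increasing_tuples_def
  by (simp add: sorted_wrt_append) (meson less_imp_le order_trans)

text \<open>The largest admissible entry can only stand last, so deciding whether it occurs
  reproduces the recursion of \<open>esym\<close>.\<close>

lemma bounded_tuples_Suc:
  "bounded_tuples (Suc M) (Suc r) =
     bounded_tuples M (Suc r) \<union> (\<lambda>ms. ms @ [Suc M]) ` bounded_tuples M r"
proof -
  have "ms \<in> bounded_tuples (Suc M) (Suc r) \<longleftrightarrow>
     ms \<in> bounded_tuples M (Suc r) \<union> (\<lambda>ms. ms @ [Suc M]) ` bounded_tuples M r" for ms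
  proof (cases ms rule: rev_cases)
    case Nil
    then show ?thesis by (auto simp: bounded_tuples_def increasing_tuples_def)
  next
    case (snoc ns m)
    have "ns @ [m] \<in> (\<lambda>ms. ms @ [Suc M]) ` bounded_tuples M r \<longleftrightarrow>
        m = Suc M \<and> ns \<in> bounded_tuples M r" by auto
    then show ?thesis
      unfolding snoc Un_iff append1_in_bounded_tuples_iff
      by (auto simp: bounded_tuples_def le_Suc_eq less_Suc_eq_le)
  qed
  then show ?thesis by blast
qed

lemma sum_bounded_tuples:
  fixes x :: "nat \<Rightarrow> 'a::comm_semiring_1"
  shows "(\<Sum>ms\<in>bounded_tuples M r. prod_list (map x ms)) = esym x M r"
proof (induction M arbitrary: r)
  case 0
  have "bounded_tuples 0 r = (if r = 0 then {[]} else {})"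
    by (cases r) (force simp: bounded_tuples_def increasing_tuples_def length_Suc_conv)+
  then show ?case by simp
next
  case (Suc M)
  show ?case
  proof (cases r)
    case 0
    then show ?thesis using Suc[of 0] by (simp add: bounded_tuples_0)
  next
    case (Suc r')
    have "bounded_tuples M (Suc r') \<inter> (\<lambda>ms. ms @ [Suc M]) ` bounded_tuples M r' = {}"
      by (auto simp: bounded_tuples_def)
    then show ?thesis
      unfolding Suc bounded_tuples_Suc
      by (simp add: sum.union_disjoint finite_bounded_tuples sum.reindex inj_on_def
          Suc.IH sum_distrib_left[symmetric] mult.commute sum_distrib_right[symmetric])
  qed
qed

text \<open>Expanding the power yields every product over distinct indices among non-negative terms.
  The bound is uniform in \<open>M\<close> once the sums of \<open>x\<close> are bounded.\<close>

lemma esym_le_power_sum: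
  fixes x :: "nat \<Rightarrow> real"
  assumes "\<And>m. x m \<ge> 0"
  shows "0 \<le> esym x M r \<and> esym x M r \<le> (\<Sum>m=1..M. x m) ^ r"
proof (induction M arbitrary: r)
  case (Suc M)
  define p where "p = (\<Sum>m=1..M. x m)"
  have p: "p \<ge> 0" using assms by (simp add: p_def sum_nonneg)
  show ?case
  proof (cases r)
    case 0
    then show ?thesis by simp
  next
    case (Suc r')
    have "esym x M r \<le> p * p ^ r'" "esym x M r' \<le> p ^ r'" "esym x M r \<ge> 0" "esym x M r' \<ge> 0"
      using Suc.IH[of r] Suc.IH[of r'] Suc by (auto simp: p_def)
    then have "esym x (Suc M) r \<le> p * p ^ r' + x (Suc M) * p ^ r'" 
      using Suc assms[of "Suc M"] by (simp add: mult_left_mono add_mono)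
    also have "\<dots> = (p + x (Suc M)) * p ^ r'" by (simp add: algebra_simps)
    also have "\<dots> \<le> (p + x (Suc M)) * (p + x (Suc M)) ^ r'"
      using p assms[of "Suc M"] by (intro mult_left_mono power_mono) auto
    finally show ?thesis
      using Suc assms[of "Suc M"] \<open>esym x M r \<ge> 0\<close> \<open>esym x M r' \<ge> 0\<close> by (simp add: p_def)
  qed
qed auto

lemma bounded_tuples_exhaust:
  assumes "finite X" "X \<subseteq> increasing_tuples r"
  shows "\<forall>\<^sub>F M in sequentially. X \<subseteq> bounded_tuples M r"
  using eventually_ge_at_top[of "Max (insert 0 (\<Union>ms\<in>X. set ms))"]
proof eventually_elim
  case (elim M)
  then show ?case using assms by (auto simp: bounded_tuples_def)
qed

text \<open>A finite set of tuples lies in some \<open>bounded_tuples M r\<close>, where the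
  absolute sum is at most \<open>S ^ r\<close>; this gives absolute summability.\<close>

lemma has_sum_increasing_tuples:
  fixes x :: "nat \<Rightarrow> complex"
  assumes "summable (\<lambda>m. norm (x (Suc m)))"
  shows "\<exists>e. ((\<lambda>ms. prod_list (map x ms)) has_sum e) (increasing_tuples r) \<and> (\<lambda>M. esym x M r) \<longlonglongrightarrow> e"
proof -
  define y where "y m = norm (x m)" for m
  define S where "S = (\<Sum>m. y (Suc m))"
  have pS: "(\<Sum>m=1..M. y m) \<le> S" for M
  proof -
    have "(\<Sum>m=1..M. y m) = (\<Sum>m<M. y (Suc m))"
      by (simp add: sum.shift_bounds_Suc_ivl[symmetric] sum.atLeast1_atMost_eq)
    also have "\<dots> \<le> S" unfolding S_def
      using assms by (intro sum_le_suminf) (auto simp: y_def)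
    finally show ?thesis .
  qed
  have norm_eq: "norm (prod_list (map x ms)) = prod_list (map y ms)" for ms
    by (induction ms) (auto simp: y_def norm_mult)
  have "(\<lambda>ms. norm (prod_list (map x ms))) summable_on increasing_tuples r"
  proof (rule nonneg_bdd_above_summable_on)
    show "bdd_above (sum (\<lambda>ms. norm (prod_list (map x ms))) ` {F. F \<subseteq> increasing_tuples r \<and> finite F})"
    proof (intro bdd_aboveI2[where M = "S ^ r"])
      fix X assume "X \<in> {F. F \<subseteq> increasing_tuples r \<and> finite F}"
      then have "\<forall>\<^sub>F M in sequentially. X \<subseteq> bounded_tuples M r"
        by (intro bounded_tuples_exhaust) auto
      from eventually_happens'[OF sequentially_bot this]
      obtain M where M: "X \<subseteq> bounded_tuples M r" by auto
      have "(\<Sum>ms\<in>X. norm (prod_list (map x ms))) \<le> (\<Sum>ms\<in>bounded_tuples M r. norm (prod_list (map x ms)))"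
        by (intro sum_mono2 finite_bounded_tuples M) auto
      also have "\<dots> = esym y M r"
        unfolding norm_eq by (rule sum_bounded_tuples)
      also have "\<dots> \<le> (\<Sum>m=1..M. y m) ^ r"
        using esym_le_power_sum[of y] by (simp add: y_def)
      also have "\<dots> \<le> S ^ r"
        using pS by (intro power_mono) (auto simp: y_def intro: sum_nonneg)
      finally show "(\<Sum>ms\<in>X. norm (prod_list (map x ms))) \<le> S ^ r" .
    qed
  qed auto
  then have "(\<lambda>ms. prod_list (map x ms)) summable_on increasing_tuples r"
    by (rule abs_summable_summable)
  then obtain e where e: "((\<lambda>ms. prod_list (map x ms)) has_sum e) (increasing_tuples r)"
    by (auto simp: summable_on_def)
  \<comment> \<open>The bounded tuples are cofinal among the finite subsets, so the unordered sum
    may be computed along them.\<close>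
  have "filterlim (\<lambda>M. bounded_tuples M r) (finite_subsets_at_top (increasing_tuples r)) sequentially"
    unfolding filterlim_finite_subsets_at_top
  proof safe
    fix X assume "finite X" "X \<subseteq> increasing_tuples r"
    then have "\<forall>\<^sub>F M in sequentially. X \<subseteq> bounded_tuples M r"
      by (rule bounded_tuples_exhaust)
    then show "\<forall>\<^sub>F M in sequentially. finite (bounded_tuples M r) \<and> X \<subseteq> bounded_tuples M r \<and>
        bounded_tuples M r \<subseteq> increasing_tuples r"
      by eventually_elim (use finite_bounded_tuples in \<open>auto simp: bounded_tuples_def\<close>)
  qed
  from filterlim_compose[OF e[unfolded has_sum_def] this] e show ?thesis
    by (auto simp: sum_bounded_tuples)
qed

lemma prod_list_powr:
  "of_nat (prod_list ms) powr s = prod_list (map (\<lambda>m. of_nat m powr s :: complex) ms)"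
  by (induction ms) (auto simp: powr_times_real)

section \<open>Multiple zeta functions and their leading coefficients\<close>

text \<open>Newton's identity solved for degree \<open>r\<close>, with zeta(js) as j-th power sum.
  Where some js = 1 the values are artefacts of the default \<open>zeta 1 = 1\<close>; only the germ
  around such points matters later.\<close>

fun newton_zeta :: "nat \<Rightarrow> complex \<Rightarrow> complex" where
  "newton_zeta r s = (if r = 0 then 1
     else (\<Sum>j=1..r. (-1) ^ (j - 1) * newton_zeta (r - j) s * zeta (of_nat j * s)) / of_nat r)"

declare newton_zeta.simps [simp del]

lemma newton_zeta_0 [simp]: "newton_zeta 0 s = 1"
  by (simp add: newton_zeta.simps)

lemma newton_zeta_newton:
  "of_nat r * newton_zeta r s = (\<Sum>j=1..r. (-1) ^ (j - 1) * newton_zeta (r - j) s * zeta (of_nat j * s))"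
  by (cases "r = 0") (simp, subst newton_zeta.simps, simp)

lemma newton_zeta_eq: "r > 0 \<Longrightarrow>
   newton_zeta r = (\<lambda>s. (\<Sum>j=1..r. (-1) ^ (j - 1) * newton_zeta (r - j) s * zeta (of_nat j * s)) / of_nat r)"
  by (rule ext, subst newton_zeta.simps) simp

text \<open>The unfolded recursion involves zeta only at js with 1 <= j <= r, so singularities can
  occur only at the points 1/j.\<close>

lemma newton_zeta_analytic:
  assumes "\<And>j. 1 \<le> j \<Longrightarrow> j \<le> r \<Longrightarrow> of_nat j * z \<noteq> 1"
  shows "newton_zeta r analytic_on {z}"
  using assms
proof (induction r rule: less_induct)
  case (less r)
  show ?case
  proof (cases "r = 0")
    case True
    then have "newton_zeta r = (\<lambda>_. 1)" by auto
    then show ?thesis by simp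
  next
    case False
    have "newton_zeta (r - j) analytic_on {z}" if "j \<in> {1..r}" for j
      using that False less.prems by (intro less.IH) auto
    moreover have "(\<lambda>s. zeta (of_nat j * s)) analytic_on {z}" if "j \<in> {1..r}" for j
      using that less.prems[of j]
      by (intro analytic_on_compose_gen[OF _ zeta_analytic, unfolded o_def] analytic_intros) auto
    ultimately show ?thesis
      using False by (subst newton_zeta_eq) (auto intro!: analytic_intros)
  qed
qed

lemma newton_zeta_meromorphic: "newton_zeta r meromorphic_on UNIV"
proof (induction r rule: less_induct)
  case (less r)
  show ?case
  proof (cases "r = 0")
    case True
    then have "newton_zeta r = (\<lambda>_. 1)" by auto
    then show ?thesis by (simp only: meromorphic_on_const)
  next
    case False
    have "(\<lambda>s. zeta (of_nat j * s)) meromorphic_on UNIV" for j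
    proof -
      have "(\<lambda>s. zeta_reg (of_nat j * s)) analytic_on UNIV"
        by (simp add: analytic_on_open)
          (intro holomorphic_on_compose_gen[OF _ zeta_reg_holomorphic, unfolded o_def] holomorphic_intros, auto)
      then have "(\<lambda>s. zeta_reg (of_nat j * s)) meromorphic_on UNIV"
        by (rule analytic_on_imp_meromorphic_on)
      then show ?thesis unfolding zeta_def by (intro meromorphic_intros)
    qed
    moreover have "newton_zeta (r - j) meromorphic_on UNIV" if "j \<in> {1..r}" for j
      using that False by (intro less.IH) auto
    ultimately show ?thesis
      using False by (subst newton_zeta_eq) (auto intro!: meromorphic_intros)
  qed
qed

section \<open>Identification of \<open>multi_zeta\<close> with the Newton recursion\<close>

lemma Re_of_nat_mult_gt_1:
  assumes "j \<ge> 1" "Re s > 1"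
  shows "Re (of_nat j * s) > 1"
proof -
  have "1 * Re s \<le> real j * Re s" using assms by (intro mult_right_mono) auto
  moreover have "Re (of_nat j * s) = real j * Re s" by simp
  ultimately show ?thesis using assms by linarith
qed

text \<open>The truncated sums satisfy Newton's identities exactly. Letting M tend to infinity,
  induction on the degree shows that their limits obey the recursion defining
  \<open>newton_zeta\<close>.\<close>

lemma newton_zeta_has_sum:
  assumes s: "Re s > 1"
  shows "((\<lambda>ms. of_nat (prod_list ms) powr (- s)) has_sum newton_zeta r s) (increasing_tuples r)"
proof -
  define x where "x m = (of_nat m powr (- s) :: complex)" for m
  have p: "(\<lambda>M. \<Sum>m=1..M. x m ^ j) \<longlonglongrightarrow> zeta (of_nat j * s)" if "j \<ge> 1" for j
  proof -
    have "(\<lambda>i. of_nat (Suc i) powr (- (of_nat j * s))) sums zeta (of_nat j * s)"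
      by (rule zeta_sums[OF Re_of_nat_mult_gt_1[OF that s]])
    moreover have "of_nat (Suc i) powr (- (of_nat j * s)) = x (Suc i) ^ j" for i
      by (simp add: x_def powr_def exp_of_nat_mult[symmetric] algebra_simps del: of_nat_Suc)
    ultimately have "(\<lambda>M. \<Sum>i<M. x (Suc i) ^ j) \<longlonglongrightarrow> zeta (of_nat j * s)"
      by (simp add: sums_def)
    then show ?thesis by (simp add: sum.atLeast1_atMost_eq)
  qed
  have "(\<lambda>M. esym x M r) \<longlonglongrightarrow> newton_zeta r s" for r
  proof (induction r rule: less_induct)
    case (less r)
    show ?case
    proof (cases "r = 0")
      case False
      then have r: "r > 0" by simp
      have "(\<lambda>M. (\<Sum>j=1..r. (-1) ^ (j - 1) * esym x M (r - j) * (\<Sum>m=1..M. x m ^ j)) / of_nat r) \<longlonglongrightarrow> newton_zeta r s"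
        unfolding newton_zeta_eq[OF r] using r
        by (intro tendsto_intros less.IH p) auto
      moreover have "(\<Sum>j=1..r. (-1) ^ (j - 1) * esym x M (r - j) * (\<Sum>m=1..M. x m ^ j)) / of_nat r = esym x M r" for M
        unfolding esym_newton[symmetric] using False by simp
      ultimately show ?thesis by simp
    qed simp
  qed
  then have lim: "(\<lambda>M. esym x M r) \<longlonglongrightarrow> newton_zeta r s" .
  have "summable (\<lambda>m. norm (x (Suc m)))"
    unfolding x_def using s by (rule summable_nat_powr)
  from has_sum_increasing_tuples[OF this, of r] obtain e where
    e: "((\<lambda>ms. prod_list (map x ms)) has_sum e) (increasing_tuples r)" "(\<lambda>M. esym x M r) \<longlonglongrightarrow> e" by blast
  have "e = newton_zeta r s" using e(2) lim by (rule LIMSEQ_unique)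
  moreover have "of_nat (prod_list ms) powr (- s) = prod_list (map x ms)" for ms
    by (simp add: prod_list_powr x_def cong: map_cong)
  ultimately show ?thesis using e(1) by simp
qed

text \<open>This makes the definite description in \<open>multi_zeta\<close> well defined. A
  difference of nicely meromorphic functions need not be nice at poles, so the identity theorem is
  applied after \<open>remove_sings\<close>; it gives equality near each point, and the conventions
  fix the value at the point.\<close>

lemma nicely_meromorphic_on_UNIV_eqI:
  assumes f: "f nicely_meromorphic_on UNIV" and g: "g nicely_meromorphic_on UNIV"
    and S: "open S" "S \<noteq> {}" and eq: "\<And>z. z \<in> S \<Longrightarrow> f z = g z"
  shows "f = g"
proof
  fix z
  define h where "h = remove_sings (\<lambda>z. f z - g z)"
  have m: "(\<lambda>z. f z - g z) meromorphic_on UNIV"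
    using f g by (intro meromorphic_intros) (auto simp: nicely_meromorphic_on_def)
  obtain a where a: "a \<in> S" using S by blast
  have "h w = 0" if "w \<in> S" for w
    unfolding h_def
  proof (rule remove_sings_eqI)
    have "\<forall>\<^sub>F v in at w. v \<in> S" using S that by (simp add: eventually_at_in_open')
    then have "\<forall>\<^sub>F v in at w. 0 = f v - g v" by eventually_elim (simp add: eq)
    then show "((\<lambda>z. f z - g z) \<longlongrightarrow> 0) (at w)"
      by (rule Lim_transform_eventually[OF tendsto_const])
  qed
  moreover have "\<forall>\<^sub>F v in at a. v \<in> S" using S a by (simp add: eventually_at_in_open')
  ultimately have "\<forall>\<^sub>F v in at a. h v = 0" by (auto elim: eventually_mono)
  then have "\<exists>\<^sub>F v in at a. h v = 0" by (intro eventually_frequently) auto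
  moreover have "h nicely_meromorphic_on UNIV"
    unfolding h_def using m by (rule remove_sings_nicely_meromorphic)
  ultimately have h0: "h w = 0" for w
    using frequently_eq_meromorphic_imp_constant[of h 0 a UNIV] by auto
  have "isolated_singularity_at (\<lambda>z. f z - g z) z"
    using m by (rule meromorphic_on_isolated_singularity[OF meromorphic_on_subset]) auto
  from eventually_remove_sings_eq_at[OF this]
  have ev: "\<forall>\<^sub>F v in at z. f v = g v"
    by eventually_elim (use h0 in \<open>auto simp: h_def\<close>)
  have pole: "is_pole f z \<longleftrightarrow> is_pole g z" using ev by (rule is_pole_cong) simp
  show "f z = g z"
  proof (cases "is_pole f z")
    case True
    \<comment> \<open>A pole excludes a finite limit, so the convention forces both values to be
      0.\<close>
    then have "f z = 0 \<and> g z = 0"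
      using f g pole unfolding nicely_meromorphic_on_def is_pole_def
      by (metis UNIV_I at_neq_bot not_tendsto_and_filterlim_at_infinity)
    then show ?thesis by simp
  next
    case False
    then have "f \<midarrow>z\<rightarrow> f z" "g \<midarrow>z\<rightarrow> g z"
      using f g pole unfolding nicely_meromorphic_on_def by auto
    then show ?thesis
      using Lim_transform_eventually[OF _ ev] LIM_unique by blast
  qed
qed

text \<open>\<open>remove_sings\<close> corrects the artificial values of \<open>newton_zeta\<close>
  and changes nothing on Re s > 1, where js = 1 is impossible for j >= 1.\<close>

lemma multi_zeta_eq: "multi_zeta r = remove_sings (newton_zeta r)"
  unfolding multi_zeta_def
proof (rule the_equality, intro conjI allI impI)
  show nice: "remove_sings (newton_zeta r) nicely_meromorphic_on UNIV"
    by (rule remove_sings_nicely_meromorphic[OF newton_zeta_meromorphic])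
  have eq: "remove_sings (newton_zeta r) s = newton_zeta r s" if s: "Re s > 1" for s
  proof (intro remove_sings_at_analytic newton_zeta_analytic notI)
    fix j assume "1 \<le> j" "of_nat j * s = 1"
    then show False using Re_of_nat_mult_gt_1[OF _ s, of j] by simp
  qed
  show sum: "((\<lambda>ms. of_nat (prod_list ms) powr (- s)) has_sum remove_sings (newton_zeta r) s) (increasing_tuples r)"
    if "1 < Re s" for s
    using newton_zeta_has_sum[OF that] eq[OF that] by simp
  fix f
  assume f: "f nicely_meromorphic_on UNIV \<and> (\<forall>s. 1 < Re s \<longrightarrow>
        ((\<lambda>ms. of_nat (prod_list ms) powr (- s)) has_sum f s) (increasing_tuples r))"
  have "(2 :: complex) \<in> {s. Re s > 1}" by simp
  then show "f = remove_sings (newton_zeta r)"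
    using f nice sum has_sum_unique
    by (intro nicely_meromorphic_on_UNIV_eqI[of _ _ "{s. Re s > 1}"] open_half_plane) blast+
qed

section \<open>Values and leading coefficients at 1/k\<close>

lemma of_nat_mult_inverse_of_nat_neq_1:
  assumes "k \<ge> 1" "j \<noteq> k"
  shows "of_nat j * (1 / of_nat k) \<noteq> (1 :: complex)"
  using assms by (simp add: divide_eq_1_iff)

lemma newton_zeta_analytic_at_inverse_nat:
  assumes "l < k"
  shows "newton_zeta l analytic_on {1 / of_nat k}"
  by (rule newton_zeta_analytic, rule of_nat_mult_inverse_of_nat_neq_1) (use assms in auto)

lemma multi_zeta_at_inverse_nat:
  assumes "l < k"
  shows "multi_zeta l (1 / of_nat k) = newton_zeta l (1 / of_nat k)"
  unfolding multi_zeta_eq by (rule remove_sings_at_analytic[OF newton_zeta_analytic_at_inverse_nat[OF assms]])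

lemma newton_zeta_sign:
  assumes "l < k"
  shows "\<exists>y>0. newton_zeta l (1 / of_nat k) = of_real ((-1) ^ l * y)"
  using assms
proof (induction l rule: less_induct)
  case (less l)
  show ?case
  proof (cases "l = 0")
    case True
    then show ?thesis by (intro exI[of _ 1]) auto
  next
    case False
    have "\<exists>y>0. newton_zeta i (1 / of_nat k) = of_real ((-1) ^ i * y)" if "i < l" for i
      using that less by auto
    then obtain y where y: "\<And>i. i < l \<Longrightarrow> y i > 0 \<and> newton_zeta i (1 / of_nat k) = of_real ((-1) ^ i * y i)"
      by metis
    have "\<exists>x<0. zeta (of_nat j * (1 / of_nat k)) = of_real x" if "j \<in> {1..l}" for j
    proof -
      have "0 < real j / real k" "real j / real k < 1" using that less.prems by auto
      then have "\<exists>x<0. zeta (of_real (real j / real k)) = of_real x" by (rule zeta_neg)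
      then show ?thesis by simp
    qed
    then obtain x where x: "\<And>j. j \<in> {1..l} \<Longrightarrow> x j < 0 \<and> zeta (of_nat j * (1 / of_nat k)) = of_real (x j)"
      by metis
    define Y where "Y = (\<Sum>j=1..l. y (l - j) * (- x j)) / real l"
    have "Y > 0"
      unfolding Y_def using False x y
      by (intro divide_pos_pos sum_pos mult_pos_pos) auto
    moreover have "newton_zeta l (1 / of_nat k) = of_real ((-1) ^ l * Y)"
    proof -
      have "(-1) ^ (j - 1) * newton_zeta (l - j) (1 / of_nat k) * zeta (of_nat j * (1 / of_nat k)) =
          of_real ((-1) ^ l * (y (l - j) * (- x j)))" if j: "j \<in> {1..l}" for j
      proof -
        \<comment> \<open>The extra factor -1 comes from zeta(j/k) < 0. Every summand then has sign
          (-1)^l, so nothing cancels.\<close>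
        have "l = Suc ((j - 1) + (l - j))" using j by auto
        then have "(-1 :: complex) ^ l = - ((-1) ^ (j - 1) * (-1) ^ (l - j))"
          by (metis power_Suc power_add mult_minus1)
        moreover have "newton_zeta (l - j) (1 / of_nat k) = of_real ((-1) ^ (l - j) * y (l - j))"
          using y[of "l - j"] j by auto
        ultimately show ?thesis using x[OF j] by simp
      qed
      then have "of_nat l * newton_zeta l (1 / of_nat k) = of_real ((-1) ^ l * (\<Sum>j=1..l. y (l - j) * (- x j)))"
        unfolding newton_zeta_newton sum_distrib_left of_real_sum by (intro sum.cong) auto
      then show ?thesis using False by (simp add: Y_def field_simps)
    qed
    ultimately show ?thesis by blast
  qed
qed

lemma newton_zeta_limit:
  assumes k: "k \<ge> 1"
  shows "((\<lambda>s. (of_nat k * s - 1) ^ (r div k) * newton_zeta r s) \<longlongrightarrow>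
    (-1) ^ ((k - 1) * (r div k)) / (of_nat k ^ (r div k) * fact (r div k)) * newton_zeta (r mod k) (1 / of_nat k))
      (at (1 / of_nat k))"
proof (induction r rule: less_induct)
  case (less r)
  define z where "z = (1 / of_nat k :: complex)"
  define u where "u s = of_nat k * s - (1 :: complex)" for s
  define A where "A q = (-1) ^ ((k - 1) * q) / (of_nat k ^ q * fact q :: complex)" for q
  define q l where "q = r div k" and "l = r mod k"
  have lk: "l < k" using k by (simp add: l_def)
  have u: "(u \<longlongrightarrow> 0) (at z)"
  proof -
    have "(u \<longlongrightarrow> of_nat k * z - 1) (at z)" unfolding u_def by (intro tendsto_intros)
    then show ?thesis using k by (simp add: z_def)
  qed
  show ?case
  proof (cases "r < k")
    case True
    have "isCont (newton_zeta r) z"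
      unfolding z_def using newton_zeta_analytic_at_inverse_nat[OF True] by (rule analytic_at_imp_isCont)
    then show ?thesis using True by (simp add: isCont_def z_def)
  next
    case False
    then have r: "r \<ge> k" "r > 0" using k by auto
    have q: "q > 0" using r k by (simp add: q_def div_greater_zero_iff)
    have IH: "((\<lambda>s. u s ^ (i div k) * newton_zeta i s) \<longlongrightarrow> A (i div k) * newton_zeta (i mod k) z) (at z)" if "i < r" for i
      using less.IH[OF that] by (simp add: A_def u_def z_def)
    \<comment> \<open>\<open>T j\<close> is the limit of the j-th summand after multiplication by
      \<open>u s ^ q\<close>. For j = k zeta supplies a simple pole and the other factor has order
      at most q - 1; for j <= l the quotient of r - j by k is still q; all other summands vanish in
      the limit.\<close>
    define T where "T j = (if j = k then (-1) ^ (k - 1) * A (q - 1) * newton_zeta l z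
      else if j \<le> l then A q * ((-1) ^ (j - 1) * newton_zeta (l - j) z * zeta (of_nat j * z)) else 0)" for j
    have lim: "((\<lambda>s. u s ^ q * ((-1) ^ (j - 1) * newton_zeta (r - j) s * zeta (of_nat j * s))) \<longlongrightarrow> T j) (at z)"
      if j: "j \<in> {1..r}" for j
    proof (cases "j = k")
      case True
      \<comment> \<open>The pole limit is over a punctured neighbourhood, so ks must approach 1
        without equalling it.\<close>
      have "filterlim (\<lambda>s. of_nat k * s) (at 1) (at z)"
        unfolding filterlim_at
      proof
        show "\<forall>\<^sub>F s in at z. of_nat k * s \<in> UNIV \<and> of_nat k * s \<noteq> 1"
          using k by (auto simp: z_def eventually_at_filter field_simps)
        show "((\<lambda>s. of_nat k * s) \<longlongrightarrow> 1) (at z)"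
          using u unfolding u_def by (simp only: LIM_zero_iff)
      qed
      from filterlim_compose[OF zeta_pole_at_1 this]
      have pole: "((\<lambda>s. u s * zeta (of_nat k * s)) \<longlongrightarrow> 1) (at z)" by (simp add: u_def)
      have "(r - k) div k = q - 1" "(r - k) mod k = l"
        using r k by (auto simp: q_def l_def le_div_geq le_mod_geq)
      with IH[of "r - k"] r k
      have rest: "((\<lambda>s. u s ^ (q - 1) * newton_zeta (r - k) s) \<longlongrightarrow> A (q - 1) * newton_zeta l z) (at z)" by simp
      have "((\<lambda>s. (-1) ^ (k - 1) * (u s ^ (q - 1) * newton_zeta (r - k) s) * (u s * zeta (of_nat k * s)))
          \<longlongrightarrow> (-1) ^ (k - 1) * (A (q - 1) * newton_zeta l z) * 1) (at z)"
        by (rule tendsto_mult[OF tendsto_mult[OF tendsto_const rest] pole])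
      moreover have "u s ^ q = u s * u s ^ (q - 1)" for s using q by (simp add: power_eq_if)
      ultimately show ?thesis using True by (simp add: T_def mult_ac)
    next
      case False
      have "zeta analytic_on {of_nat j * z}"
        by (rule analytic_on_subset[OF zeta_analytic])
          (use of_nat_mult_inverse_of_nat_neq_1[OF k False] in \<open>simp add: z_def\<close>)
      then have "isCont zeta (of_nat j * z)" by (rule analytic_at_imp_isCont)
      then have zl: "((\<lambda>s. zeta (of_nat j * s)) \<longlongrightarrow> zeta (of_nat j * z)) (at z)"
        by (rule isCont_tendsto_compose) (intro tendsto_intros)
      have IHj: "((\<lambda>s. u s ^ ((r - j) div k) * newton_zeta (r - j) s) \<longlongrightarrow> A ((r - j) div k) * newton_zeta ((r - j) mod k) z) (at z)"
        by (rule IH) (use j r in auto)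
      have rql: "r = q * k + l" by (simp add: q_def l_def)
      show ?thesis
      proof (cases "j \<le> l")
        case True
        then have "r - j = (l - j) + q * k" using rql by simp
        then have "(r - j) div k = q" "(r - j) mod k = l - j" using lk k by auto
        with IHj have "((\<lambda>s. u s ^ q * newton_zeta (r - j) s) \<longlongrightarrow> A q * newton_zeta (l - j) z) (at z)" by simp
        from tendsto_mult[OF tendsto_mult[OF tendsto_const this] zl]
        have "((\<lambda>s. (-1) ^ (j - 1) * (u s ^ q * newton_zeta (r - j) s) * zeta (of_nat j * s)) \<longlongrightarrow>
            (-1) ^ (j - 1) * (A q * newton_zeta (l - j) z) * zeta (of_nat j * z)) (at z)" .
        then show ?thesis using True False by (simp add: T_def mult_ac)
      next
        case jl: False
        moreover have "0 < q * k" using q k by simp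
        ultimately have "r - j < q * k" using rql by linarith
        \<comment> \<open>A positive power of \<open>u s\<close> is left over after the induction
          hypothesis has used its share, and it forces the limit 0.\<close>
        then have "(r - j) div k < q" by (simp add: less_mult_imp_div_less)
        then obtain d where d: "q = (r - j) div k + Suc d" using less_iff_Suc_add by auto
        have "((\<lambda>s. (-1) ^ (j - 1) * u s ^ Suc d * (u s ^ ((r - j) div k) * newton_zeta (r - j) s) * zeta (of_nat j * s)) \<longlongrightarrow>
            (-1) ^ (j - 1) * 0 ^ Suc d * (A ((r - j) div k) * newton_zeta ((r - j) mod k) z) * zeta (of_nat j * z)) (at z)"
          by (rule tendsto_mult[OF tendsto_mult[OF tendsto_mult[OF tendsto_const tendsto_power[OF u]] IHj] zl])
        then show ?thesis using jl False by (subst d) (simp add: T_def mult_ac power_add)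
      qed
    qed
    \<comment> \<open>The term j = k carries weight kq because (-1)^(k-1) A(q-1) = kq A(q). The
      terms j <= l recombine by Newton's identity of degree l with weight l, and kq + l = r.\<close>
    have sumT: "(\<Sum>j=1..r. T j) = of_nat r * (A q * newton_zeta l z)"
    proof -
      have "(\<Sum>j=1..r. T j) = (\<Sum>j\<in>insert k {1..l}. T j)"
        using r lk k by (intro sum.mono_neutral_right) (auto simp: T_def)
      also have "\<dots> = T k + (\<Sum>j=1..l. T j)" using lk by simp
      also have "(\<Sum>j=1..l. T j) = (\<Sum>j=1..l. A q * ((-1) ^ (j - 1) * newton_zeta (l - j) z * zeta (of_nat j * z)))"
        using lk by (intro sum.cong) (auto simp: T_def)
      also have "\<dots> = A q * (of_nat l * newton_zeta l z)"
        unfolding newton_zeta_newton by (simp add: sum_distrib_left)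
      also have "T k = of_nat (k * q) * A q * newton_zeta l z"
      proof -
        obtain p where p: "q = Suc p" using q by (cases q) auto
        define m where "m = k - 1"
        have "(-1) ^ (k - 1) * A p = of_nat (k * q) * A q"
          unfolding A_def p m_def[symmetric] using k
          by (simp add: power_add field_simps del: of_nat_Suc) (simp add: algebra_simps)
        then show ?thesis by (simp add: T_def p)
      qed
      also have "of_nat (k * q) * A q * newton_zeta l z + A q * (of_nat l * newton_zeta l z) = of_nat (k * q + l) * (A q * newton_zeta l z)"
        by (simp add: algebra_simps)
      also have "k * q + l = r" by (simp add: q_def l_def)
      finally show ?thesis .
    qed
    have "((\<lambda>s. (\<Sum>j=1..r. u s ^ q * ((-1) ^ (j - 1) * newton_zeta (r - j) s * zeta (of_nat j * s))) / of_nat r)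
        \<longlongrightarrow> (\<Sum>j=1..r. T j) / of_nat r) (at z)"
      using r by (intro tendsto_intros lim) auto
    moreover have "(\<Sum>j=1..r. u s ^ q * ((-1) ^ (j - 1) * newton_zeta (r - j) s * zeta (of_nat j * s))) / of_nat r
        = u s ^ q * newton_zeta r s" for s
      unfolding sum_distrib_left[symmetric] newton_zeta_newton[symmetric] using r by simp
    ultimately have "((\<lambda>s. u s ^ q * newton_zeta r s) \<longlongrightarrow> A q * newton_zeta l z) (at z)"
      using r sumT by simp
    then show ?thesis by (simp add: u_def A_def z_def q_def l_def)
  qed
qed

text \<open>\<open>multi_zeta r\<close> and \<open>newton_zeta r\<close> agree on a punctured
  neighbourhood, which is all that the limit sees.\<close>

lemma normalized_zeta_tendsto:
  assumes k: "k \<ge> 1"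
  shows "(normalized_zeta r k \<longlongrightarrow>
    (-1) ^ ((k - 1) * (r div k)) / (of_nat k ^ (r div k) * fact (r div k)) * newton_zeta (r mod k) (1 / of_nat k))
      (at (1 / of_nat k))"
proof -
  have "isolated_singularity_at (newton_zeta r) (1 / of_nat k)"
    using newton_zeta_meromorphic by (rule meromorphic_on_isolated_singularity[OF meromorphic_on_subset]) auto
  from eventually_remove_sings_eq_at[OF this]
  have "\<forall>\<^sub>F s in at (1 / of_nat k). (of_nat k * s - 1) ^ (r div k) * newton_zeta r s = normalized_zeta r k s"
    by eventually_elim (simp add: normalized_zeta_def multi_zeta_eq)
  then show ?thesis by (rule Lim_transform_eventually[OF newton_zeta_limit[OF k]])
qed

lemma C_eq:
  assumes "k \<ge> 1"
  shows "C r k = (-1) ^ ((k - 1) * (r div k)) / (of_nat k ^ (r div k) * fact (r div k))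
     * newton_zeta (r mod k) (1 / of_nat k)"
  unfolding C_def by (rule tendsto_Lim[OF _ normalized_zeta_tendsto[OF assms]]) simp

text \<open>All explicit formulas are instances: q = 1 for k > r/2, k = 1 with l = 0 for the pole at
  1, and general q for multiples of k plus a remainder.\<close>

lemma C_mult_add_eq:
  assumes "l < k"
  shows "C (k * q + l) k = (-1) ^ ((k - 1) * q) / (of_nat k ^ q * fact q) * newton_zeta l (1 / of_nat k)"
  using C_eq[of k "k * q + l"] assms by simp

theorem theorem3:
  "(\<forall>r k. 1 \<le> k \<and> k \<le> r \<longrightarrow>
      (normalized_zeta r k \<longlongrightarrow> C r k) (at (1 / of_nat k)) \<and> C r k \<in> \<real> \<and> C r k \<noteq> 0) \<and>
   (\<forall>r\<ge>1. C r r = (-1) ^ (r - 1) / of_nat r) \<and>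
   (\<forall>r k. real r / 2 < real k \<and> k \<le> r - 1 \<longrightarrow>
      C r k = (-1) ^ (k - 1) / of_nat k * multi_zeta (r - k) (1 / of_nat k)) \<and>
   (\<forall>r\<ge>1. C r 1 = 1 / fact r) \<and>
   (\<forall>k\<ge>2.
      (\<forall>r\<ge>1. C (k * r) k = (-1) ^ ((k - 1) * r) / (of_nat k ^ r * fact r)) \<and>
      (\<forall>r l. 1 \<le> r \<and> 1 \<le> l \<and> l \<le> k - 1 \<longrightarrow>
         C (k * r + l) k =
           (-1) ^ ((k - 1) * r) / (of_nat k ^ r * fact r) * multi_zeta l (1 / of_nat k)))"
proof (intro conjI allI impI)
  fix r k :: nat
  assume k: "1 \<le> k \<and> k \<le> r"
  show "(normalized_zeta r k \<longlongrightarrow> C r k) (at (1 / of_nat k))"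
    using normalized_zeta_tendsto[of k r] k by (simp add: C_eq)
  \<comment> \<open>The remainder is below k, so the sign lemma applies and yields both reality and
    non-vanishing.\<close>
  have "r mod k < k" using k by simp
  from newton_zeta_sign[OF this] obtain y where
    y: "y > 0" "newton_zeta (r mod k) (1 / of_nat k) = of_real ((-1) ^ (r mod k) * y)" by blast
  have "C r k = of_real ((-1) ^ ((k - 1) * (r div k)) / (real k ^ (r div k) * fact (r div k))
      * ((-1) ^ (r mod k) * y))"
    using k y by (simp add: C_eq)
  then show "C r k \<in> \<real>" by (simp only: Reals_of_real)
  show "C r k \<noteq> 0"
    using k y by (simp add: C_eq)
next
  fix r :: nat
  assume "1 \<le> r"
  then show "C r r = (-1) ^ (r - 1) / of_nat r"
    using C_mult_add_eq[of 0 r 1] by simp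
next
  fix r k :: nat
  assume "real r / 2 < real k \<and> k \<le> r - 1"
  then have "r - k < k" "k \<le> r" by linarith+
  then show "C r k = (-1) ^ (k - 1) / of_nat k * multi_zeta (r - k) (1 / of_nat k)"
    using C_mult_add_eq[of "r - k" k 1] by (simp add: multi_zeta_at_inverse_nat)
next
  fix r :: nat
  show "C r 1 = 1 / fact r"
    using C_mult_add_eq[of 0 1 r] by simp
next
  fix k r :: nat
  assume "2 \<le> k"
  then show "C (k * r) k = (-1) ^ ((k - 1) * r) / (of_nat k ^ r * fact r)"
    using C_mult_add_eq[of 0 k r] by simp
next
  fix k r l :: nat
  assume "2 \<le> k" "1 \<le> r \<and> 1 \<le> l \<and> l \<le> k - 1"
  then have "l < k" by linarith
  then show "C (k * r + l) k =
      (-1) ^ ((k - 1) * r) / (of_nat k ^ r * fact r) * multi_zeta l (1 / of_nat k)"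
    using C_mult_add_eq[of l k r] by (simp add: multi_zeta_at_inverse_nat)
qed

end
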